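(* Let $n \le l$ be positive integers, let $x_1,\ldots,x_{l+1}$ be real numbers with $0 < x_1 < x_2 < \cdots < x_l < x_{l+1} < 1$, and let $A=(a_{i,j})_{1\le i\le l+1;\,1\le j\le n+1}$ be the $(l+1)\times(n+1)$ Bernstein-Vandermonde matrix for the Bernstein basis $\mathcal{B}_n$ and the nodes $x_1,\ldots,x_{l+1}$, that is, $$a_{i,j} = \binom{n}{j-1}\, x_i^{\,j-1}(1-x_i)^{\,n-j+1}, \qquad 1\le i\le l+1,\ 1\le j\le n+1.$$ Then $A$ admits a factorization of the form $$A = F_l F_{l-1}\cdots F_1\, D\, G_1 \cdots G_{n-1} G_n,$$ where $G_j$ ($j=1,\ldots,n$) are real $(n+1)\times(n+1)$ upper triangular bidiagonal matrices, $F_i$ ($i=1,\ldots,l$) are real $(l+1)\times(l+1)$ lower triangular bidiagonal matrices, and $D$ is a real $(l+1)\times(n+1)$ diagonal matrix.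
   Context: The Bernstein basis of the space of real polynomials of degree less than or equal to $n$ on $[0,1]$ is $\mathcal{B}_n=\{ b_j^{(n)}(x)=\binom{n}{j}(1-x)^{n-j}x^j : j=0,\ldots,n\}$. The Bernstein-Vandermonde matrix for $\mathcal{B}_n$ and nodes $x_1,\ldots,x_{l+1}$ is the $(l+1)\times(n+1)$ matrix whose $(i,j)$ entry is $b_{j-1}^{(n)}(x_i)$. A square matrix is lower (respectively upper) triangular bidiagonal if all its entries outside the main diagonal and the first subdiagonal (respectively first superdiagonal) are zero. A rectangular matrix $D=(d_{i,j})$ is diagonal if $d_{i,j}=0$ whenever $i\ne j$. *)

theory Defs
  imports "HOL-Analysis.Weierstrass_Theorems" "Jordan_Normal_Form.Matrix"
begin

text \<open>Nodes are numbered from 1 (\<open>x 1, ..., x (l+1)\<close>), matrix rows and columns from 0.\<close>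

definition bernstein_vandermonde :: "nat \<Rightarrow> nat \<Rightarrow> (nat \<Rightarrow> real) \<Rightarrow> real mat" where
  "bernstein_vandermonde l n x = mat (l + 1) (n + 1) (\<lambda>(i, j). Bernstein n j (x (i + 1)))"

definition lower_bidiagonal :: "'a::zero mat \<Rightarrow> bool" where
  "lower_bidiagonal M \<longleftrightarrow> square_mat M \<and>
     (\<forall>i<dim_row M. \<forall>j<dim_col M. i \<noteq> j \<and> i \<noteq> j + 1 \<longrightarrow> M $$ (i, j) = 0)"

definition upper_bidiagonal :: "'a::zero mat \<Rightarrow> bool" where
  "upper_bidiagonal M \<longleftrightarrow> square_mat M \<and>
     (\<forall>i<dim_row M. \<forall>j<dim_col M. i \<noteq> j \<and> j \<noteq> i + 1 \<longrightarrow> M $$ (i, j) = 0)"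

text \<open>Product, from left to right, of a list of matrices of size \<open>m \<times> m\<close>. The type of
  matrices is not a monoid (the identity depends on the size), so \<open>prod_list\<close> does not apply.\<close>

definition mat_prod :: "nat \<Rightarrow> 'a::semiring_1 mat list \<Rightarrow> 'a mat" where
  "mat_prod m Ms = foldr (*) Ms (1\<^sub>m m)"

end

theory Submission
  imports Defs
begin

text \<open>Put \<open>t = x / (1 - x)\<close>. Then \<open>Bernstein n j x = (1 - x)^n * (n choose j) * t^j\<close>, so the
  matrix is a Vandermonde matrix \<open>(t\<^sub>i^j)\<close> whose rows and columns are scaled by nonzero
  numbers \<open>w\<^sub>i\<close> and \<open>b\<^sub>j\<close>, and the nodes \<open>t\<^sub>i\<close> are still distinct.

  Read the unscaled matrix as a table of functionals (evaluation at \<open>t\<^sub>i\<close>) applied to polynomials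
  (the monomials \<open>t^j\<close>). Let \<open>N\<^sub>k = (t - t\<^sub>0) \<cdots> (t - t\<^sub>k\<^sub>-\<^sub>1)\<close> be the Newton basis.
  The divided differences \<open>[t\<^sub>0, \<dots>, t\<^sub>i]\<close> form the dual basis of the Newton basis
  (lemma \<open>divdiff_newton\<close>), so replacing both the functionals and the polynomials leaves a
  diagonal matrix. Both replacements are done in steps that are bidiagonal:

  \<^item> The functionals pass through the stages \<open>[t\<^sub>c, \<dots>, t\<^sub>i]\<close> for \<open>c = l, \<dots>, 0\<close>, where this
    means evaluation at \<open>t\<^sub>i\<close> if \<open>i \<le> c\<close>. The recurrence of divided differences writes the functional
    \<open>i\<close> of stage \<open>c + 1\<close> through the functionals \<open>i\<close> and \<open>i - 1\<close> of stage \<open>c\<close>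
    (lemma \<open>divdiff_Suc\<close>); this is the factor \<open>F\<^sub>c\<^sub>+\<^sub>1\<close>.

  \<^item> The polynomials pass through the stages \<open>t^k * N\<^sub>j\<^sub>-\<^sub>k\<close> for \<open>k = n, \<dots>, 0\<close>, where this
    means \<open>t^j\<close> if \<open>j \<le> k\<close>. Writing one factor \<open>t\<close> as \<open>(t - t\<^sub>m) + t\<^sub>m\<close> with
    \<open>m = j - k - 1\<close> expresses the polynomial \<open>j\<close> of stage \<open>k + 1\<close> through the
    polynomials \<open>j\<close> and \<open>j - 1\<close> of stage \<open>k\<close>
    (lemma \<open>newton_stage_Suc\<close>); this is the factor \<open>G\<^sub>k\<^sub>+\<^sub>1\<close>.

  The scalings \<open>w\<^sub>i\<close> and \<open>b\<^sub>j\<close> are kept at every stage and end up in the diagonal factor.\<close>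

section \<open>Bidiagonal matrices and products of lists\<close>

definition lower_bidiag :: "nat \<Rightarrow> (nat \<Rightarrow> 'a) \<Rightarrow> (nat \<Rightarrow> 'a) \<Rightarrow> 'a::zero mat" where
  "lower_bidiag m d e = mat m m (\<lambda>(i, j). if j = i then d i else if i = Suc j then e i else 0)"

definition upper_bidiag :: "nat \<Rightarrow> (nat \<Rightarrow> 'a) \<Rightarrow> (nat \<Rightarrow> 'a) \<Rightarrow> 'a::zero mat" where
  "upper_bidiag m d e = mat m m (\<lambda>(i, j). if i = j then d j else if j = Suc i then e j else 0)"

lemma lower_bidiag_carrier [simp]: "lower_bidiag m d e \<in> carrier_mat m m"
  by (simp add: lower_bidiag_def)

lemma upper_bidiag_carrier [simp]: "upper_bidiag m d e \<in> carrier_mat m m"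
  by (simp add: upper_bidiag_def)

lemma lower_bidiagonal_lower_bidiag: "lower_bidiagonal (lower_bidiag m d e)"
  by (auto simp: lower_bidiagonal_def lower_bidiag_def)

lemma upper_bidiagonal_upper_bidiag: "upper_bidiagonal (upper_bidiag m d e)"
  by (auto simp: upper_bidiagonal_def upper_bidiag_def)

lemma lower_bidiag_mult_index:
  fixes M :: "'a::semiring_1 mat"
  assumes M: "M \<in> carrier_mat m p" and i: "i < m" and k: "k < p"
  shows "(lower_bidiag m d e * M) $$ (i, k) =
    d i * M $$ (i, k) + (if i = 0 then 0 else e i * M $$ (i - 1, k))"
proof -
  have "(lower_bidiag m d e * M) $$ (i, k) =
      (\<Sum>j<m. (if j = i then d i * M $$ (j, k) else 0)
            + (if i = Suc j then e i * M $$ (j, k) else 0))"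
    using assms by (auto simp: lower_bidiag_def scalar_prod_def lessThan_atLeast0 intro!: sum.cong)
  also have "\<dots> = d i * M $$ (i, k) + (\<Sum>j<m. if i = Suc j then e i * M $$ (j, k) else 0)"
    using i by (simp add: sum.distrib)
  also have "(\<Sum>j<m. if i = Suc j then e i * M $$ (j, k) else 0) =
      (if i = 0 then 0 else e i * M $$ (i - 1, k))"
    using i by (cases i) auto
  finally show ?thesis .
qed

lemma mult_upper_bidiag_index:
  fixes M :: "'a::semiring_1 mat"
  assumes M: "M \<in> carrier_mat p m" and i: "i < p" and k: "k < m"
  shows "(M * upper_bidiag m d e) $$ (i, k) =
    M $$ (i, k) * d k + (if k = 0 then 0 else M $$ (i, k - 1) * e k)"
proof -
  have "(M * upper_bidiag m d e) $$ (i, k) =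
      (\<Sum>j<m. (if j = k then M $$ (i, j) * d k else 0)
            + (if k = Suc j then M $$ (i, j) * e k else 0))"
    using assms by (auto simp: upper_bidiag_def scalar_prod_def lessThan_atLeast0 intro!: sum.cong)
  also have "\<dots> = M $$ (i, k) * d k + (\<Sum>j<m. if k = Suc j then M $$ (i, j) * e k else 0)"
    using k by (simp add: sum.distrib)
  also have "(\<Sum>j<m. if k = Suc j then M $$ (i, j) * e k else 0) =
      (if k = 0 then 0 else M $$ (i, k - 1) * e k)"
    using k by (cases k) auto
  finally show ?thesis .
qed

lemma mat_prod_carrier:
  "set Ms \<subseteq> carrier_mat m m \<Longrightarrow> mat_prod m Ms \<in> carrier_mat m m"
  by (induction Ms) (auto simp: mat_prod_def)

lemma mat_prod_snoc:
  fixes Ms :: "'a::semiring_1 mat list"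
  assumes "set Ms \<subseteq> carrier_mat m m" and "M \<in> carrier_mat m m"
  shows "mat_prod m (Ms @ [M]) = mat_prod m Ms * M"
  using assms(1)
proof (induction Ms)
  case Nil
  then show ?case using assms(2) by (simp add: mat_prod_def)
next
  case (Cons A Ms)
  then have "mat_prod m ((A # Ms) @ [M]) = A * (mat_prod m Ms * M)"
    by (simp add: mat_prod_def)
  also have "\<dots> = A * mat_prod m Ms * M"
    using Cons.prems assms(2) mat_prod_carrier[of Ms m]
    by (intro assoc_mult_mat[symmetric, where ?n\<^sub>1 = m and ?n\<^sub>2 = m and ?n\<^sub>3 = m and ?n\<^sub>4 = m]) auto
  finally show ?case by (simp add: mat_prod_def)
qed

lemma mat_prod_left_telescope:
  fixes M F :: "nat \<Rightarrow> 'a::semiring_1 mat"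
  assumes F: "\<And>c. F c \<in> carrier_mat m m" and M0: "M 0 \<in> carrier_mat m p"
    and step: "\<And>c. c < l \<Longrightarrow> M (Suc c) = F (Suc c) * M c"
  shows "M l = mat_prod m (map F (rev [1..<l + 1])) * M 0"
  using step
proof (induction l)
  case 0
  then show ?case using M0 by (simp add: mat_prod_def)
next
  case (Suc l)
  let ?P = "mat_prod m (map F (rev [1..<l + 1]))"
  have P: "?P \<in> carrier_mat m m"
    using F by (intro mat_prod_carrier) auto
  have "M (Suc l) = F (Suc l) * (?P * M 0)"
    using Suc by simp
  also have "\<dots> = F (Suc l) * ?P * M 0"
    using F[of "Suc l"] P M0 by (rule assoc_mult_mat[symmetric])
  finally show ?case by (simp add: mat_prod_def)
qed

lemma mat_prod_right_telescope:
  fixes M G :: "nat \<Rightarrow> 'a::semiring_1 mat"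
  assumes G: "\<And>k. G k \<in> carrier_mat m m" and M0: "M 0 \<in> carrier_mat p m"
    and step: "\<And>k. k < n \<Longrightarrow> M (Suc k) = M k * G (Suc k)"
  shows "M n = M 0 * mat_prod m (map G [1..<n + 1])"
  using step
proof (induction n)
  case 0
  then show ?case using M0 by (simp add: mat_prod_def)
next
  case (Suc n)
  let ?P = "mat_prod m (map G [1..<n + 1])"
  have P: "?P \<in> carrier_mat m m"
    using G by (intro mat_prod_carrier) auto
  have "M (Suc n) = M 0 * ?P * G (Suc n)"
    using Suc by simp
  also have "\<dots> = M 0 * (?P * G (Suc n))"
    using M0 P G by (rule assoc_mult_mat)
  also have "?P * G (Suc n) = mat_prod m (map G [1..<n + 1] @ [G (Suc n)])"
    using G by (intro mat_prod_snoc[symmetric]) auto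
  finally show ?case by simp
qed

section \<open>Divided differences and the Newton basis\<close>

text \<open>The divided difference over the nodes \<open>t c, \<dots>, t i\<close> of the function with value \<open>f m\<close> at
  the node \<open>t m\<close>. For \<open>i < c\<close> it is set to the plain value \<open>f i\<close>: the rows of index at most
  \<open>c\<close> are the ones that stage \<open>c\<close> leaves alone.\<close>

function divdiff :: "(nat \<Rightarrow> 'a::field) \<Rightarrow> (nat \<Rightarrow> 'a) \<Rightarrow> nat \<Rightarrow> nat \<Rightarrow> 'a" where
  "i \<le> c \<Longrightarrow> divdiff t f c i = f i"
| "c < i \<Longrightarrow> divdiff t f c i = (divdiff t f (Suc c) i - divdiff t f c (i - 1)) / (t i - t c)"
  by force+
termination by (relation "measure (\<lambda>(t, f, c, i). i - c)") auto

declare divdiff.simps(2) [simp del]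

text \<open>Solving the recurrence for the term with the larger starting index is what
  makes the step from stage \<open>c\<close> to stage \<open>c + 1\<close> bidiagonal.\<close>

lemma divdiff_Suc:
  assumes "c < i" and "t i \<noteq> t c"
  shows "divdiff t f (Suc c) i = (t i - t c) * divdiff t f c i + divdiff t f c (i - 1)"
  using assms by (simp add: divdiff.simps(2))

text \<open>The Leibniz rule for a product with a linear factor, whose own divided differences are
  \<open>t c - a\<close>, \<open>1\<close>, and then \<open>0\<close>.\<close>

lemma divdiff_linear_mult:
  assumes "inj_on t {..l}" and "c < i" and "i \<le> l"
  shows "divdiff t (\<lambda>m. (t m - a) * g m) c i = (t c - a) * divdiff t g c i + divdiff t g (Suc c) i"
  using assms(2,3)
proof (induction "i - c" arbitrary: c i rule: less_induct)
  case less
  let ?f = "\<lambda>m. (t m - a) * g m"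
  have ne: "t i \<noteq> t c"
    using assms(1) less.prems by (auto dest: inj_onD)
  have "divdiff t ?f (Suc c) i - divdiff t ?f c (i - 1) =
      (t i - t c) * ((t c - a) * divdiff t g c i + divdiff t g (Suc c) i)"
  proof (cases "i = Suc c")
    case True
    then have g: "g (Suc c) = (t (Suc c) - t c) * divdiff t g c (Suc c) + g c"
      using divdiff_Suc[OF less.prems(1) ne, of g] by simp
    show ?thesis
      unfolding True by (simp add: g) (simp add: algebra_simps)
  next
    case False
    then have c: "Suc c < i" using less.prems by simp
    have ne': "t i \<noteq> t (Suc c)"
      using assms(1) c less.prems by (auto dest: inj_onD)
    have left: "divdiff t ?f (Suc c) i =
        (t (Suc c) - a) * divdiff t g (Suc c) i + divdiff t g (Suc (Suc c)) i"
      using less.hyps[of i "Suc c"] c less.prems by simp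
    have right: "divdiff t ?f c (i - 1) =
        (t c - a) * divdiff t g c (i - 1) + divdiff t g (Suc c) (i - 1)"
      using less.hyps[of "i - 1" c] c less.prems by simp
    show ?thesis
      unfolding left right divdiff_Suc[OF c ne', of g] divdiff_Suc[OF less.prems(1) ne, of g]
      by (simp add: algebra_simps)
  qed
  then show ?case
    using ne less.prems by (simp add: divdiff.simps(2))
qed

lemma divdiff_const:
  "c < i \<Longrightarrow> divdiff t (\<lambda>_. a) c i = 0"
proof (induction "i - c" arbitrary: c i rule: less_induct)
  case less
  have "divdiff t (\<lambda>_. a) (Suc c) i = divdiff t (\<lambda>_. a) c (i - 1)"
    using less.hyps[of i "Suc c"] less.hyps[of "i - 1" c] less.prems
    by (cases "i = Suc c") simp_all
  then show ?case
    using less.prems by (simp add: divdiff.simps(2))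
qed

text \<open>Duality of divided differences and the Newton basis. The starting index \<open>c\<close> is general
  because the proof splits off the first linear factor, which moves the start to \<open>c + 1\<close>.\<close>

lemma divdiff_newton:
  assumes "inj_on t {..l}" and "c \<le> i" and "i \<le> l"
  shows "divdiff t (\<lambda>m. \<Prod>r<k. t m - t (c + r)) c i = (if i = c + k then 1 else 0)"
  using assms(2)
proof (induction k arbitrary: c)
  case 0
  then show ?case by (cases "i = c") (simp_all add: divdiff_const)
next
  case (Suc k)
  have shift: "(\<Prod>r<Suc k. t m - t (c + r)) = (t m - t c) * (\<Prod>r<k. t m - t (Suc c + r))" for m
    by (subst prod.lessThan_Suc_shift) simp
  show ?case
  proof (cases "i = c")
    case True
    then show ?thesis by (simp add: shift del: prod.lessThan_Suc)
  next
    case False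
    then have "c < i" using Suc.prems by simp
    then show ?thesis
      using Suc.IH[of "Suc c"] divdiff_linear_mult[OF assms(1) _ assms(3), of c "t c"]
      by (simp add: shift del: prod.lessThan_Suc)
  qed
qed

text \<open>The polynomial of index \<open>j\<close> at stage \<open>k\<close>, evaluated at \<open>y\<close>. Truncated subtraction makes
  it the monomial \<open>y^j\<close> for \<open>j \<le> k\<close>.\<close>

definition newton_stage :: "(nat \<Rightarrow> 'a::comm_ring_1) \<Rightarrow> nat \<Rightarrow> nat \<Rightarrow> 'a \<Rightarrow> 'a" where
  "newton_stage t k j y = y ^ min k j * (\<Prod>r<j - k. y - t r)"

lemma newton_stage_Suc:
  "newton_stage t (Suc k) j y = newton_stage t k j y +
     (if j \<le> k then 0 else t (j - Suc k) * newton_stage t k (j - 1) y)"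
proof (cases "j \<le> k")
  case True
  then show ?thesis by (simp add: newton_stage_def)
next
  case False
  then obtain m where "j = Suc (k + m)"
    by (metis add_Suc less_imp_Suc_add not_le)
  then show ?thesis by (simp add: newton_stage_def algebra_simps)
qed

section \<open>The factorization\<close>

text \<open>The bidiagonal factors compare neighbouring rows and columns, so at each stage they carry the
  ratios \<open>w i / w (i - 1)\<close> and \<open>b j / b (j - 1)\<close>. This is where nonzero scalings are used.\<close>

theorem scaled_vandermonde_bidiagonal_factorization:
  fixes t w b :: "nat \<Rightarrow> 'a::field"
  assumes inj: "inj_on t {..l}"
    and w: "\<And>i. i \<le> l \<Longrightarrow> w i \<noteq> 0" and b: "\<And>j. j \<le> n \<Longrightarrow> b j \<noteq> 0"
  obtains F D G where
    "\<And>i. F i \<in> carrier_mat (l + 1) (l + 1)" "\<And>i. lower_bidiagonal (F i)"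
    "D \<in> carrier_mat (l + 1) (n + 1)" "diagonal_mat D"
    "\<And>j. G j \<in> carrier_mat (n + 1) (n + 1)" "\<And>j. upper_bidiagonal (G j)"
    "mat (l + 1) (n + 1) (\<lambda>(i, j). w i * b j * t i ^ j) =
      mat_prod (l + 1) (map F (rev [1..<l + 1])) * D * mat_prod (n + 1) (map G [1..<n + 1])"
proof -
  define N where "N k m = (\<Prod>r<k. t m - t r)" for k m
  define L where "L c = mat (l + 1) (n + 1) (\<lambda>(i, k). w i * b k * divdiff t (N k) c i)" for c
  define Q where "Q k = mat (l + 1) (n + 1) (\<lambda>(i, j). w i * b j * newton_stage t k j (t i))" for k
  \<comment> \<open>The factor of index \<open>p\<close> leads from stage \<open>p - 1\<close> to stage \<open>p\<close>.\<close>
  define F where "F p = lower_bidiag (l + 1) (\<lambda>i. if i < p then 1 else t i - t (p - 1))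
      (\<lambda>i. if i < p then 0 else w i / w (i - 1))" for p
  define G where "G p = upper_bidiag (n + 1) (\<lambda>_. 1)
      (\<lambda>j. if j < p then 0 else b j / b (j - 1) * t (j - p))" for p
  define D where "D = mat (l + 1) (n + 1) (\<lambda>(i, j). if i = j then w i * b j else 0)"

  have L_carrier: "L c \<in> carrier_mat (l + 1) (n + 1)" for c by (simp add: L_def)
  have Q_carrier: "Q k \<in> carrier_mat (l + 1) (n + 1)" for k by (simp add: Q_def)
  have F_carrier: "F p \<in> carrier_mat (l + 1) (l + 1)" for p by (simp add: F_def)
  have G_carrier: "G p \<in> carrier_mat (n + 1) (n + 1)" for p by (simp add: G_def)

  have L_step: "L (Suc c) = F (Suc c) * L c" for c
  proof (rule eq_matI)
    fix i k assume "i < dim_row (F (Suc c) * L c)" "k < dim_col (F (Suc c) * L c)"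
    then have ik: "i < l + 1" "k < n + 1"
      using F_carrier[of "Suc c"] L_carrier[of c] by auto
    have prod: "(F (Suc c) * L c) $$ (i, k) =
        (if i < Suc c then 1 else t i - t c) * L c $$ (i, k) +
        (if i = 0 then 0 else (if i < Suc c then 0 else w i / w (i - 1)) * L c $$ (i - 1, k))"
      unfolding F_def by (subst lower_bidiag_mult_index[OF L_carrier ik]) simp
    show "L (Suc c) $$ (i, k) = (F (Suc c) * L c) $$ (i, k)"
    proof (cases "i \<le> c")
      case True
      then show ?thesis unfolding prod using ik by (simp add: L_def)
    next
      case False
      then have "t i \<noteq> t c" using inj ik by (auto dest: inj_onD)
      then show ?thesis unfolding prod
        using False ik w[of "i - 1"]
        by (simp add: L_def divdiff_Suc field_simps)
    qed
  qed (use F_carrier[of "Suc c"] L_carrier[of c] L_carrier[of "Suc c"] in auto)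

  have Q_step: "Q (Suc k) = Q k * G (Suc k)" for k
  proof (rule eq_matI)
    fix i j assume "i < dim_row (Q k * G (Suc k))" "j < dim_col (Q k * G (Suc k))"
    then have ij: "i < l + 1" "j < n + 1"
      using G_carrier[of "Suc k"] Q_carrier[of k] by auto
    have prod: "(Q k * G (Suc k)) $$ (i, j) = Q k $$ (i, j) * 1 +
        (if j = 0 then 0 else Q k $$ (i, j - 1) *
          (if j < Suc k then 0 else b j / b (j - 1) * t (j - Suc k)))"
      unfolding G_def by (subst mult_upper_bidiag_index[OF Q_carrier ij]) simp
    show "Q (Suc k) $$ (i, j) = (Q k * G (Suc k)) $$ (i, j)"
      unfolding prod using ij b[of "j - 1"]
      by (auto simp: Q_def newton_stage_Suc field_simps)
  qed (use G_carrier[of "Suc k"] Q_carrier[of k] Q_carrier[of "Suc k"] in auto)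

  have "L 0 = D"
    unfolding L_def D_def N_def
  proof (rule cong_mat)
    fix i k assume "i < l + 1"
    then show "(case (i, k) of (i, k) \<Rightarrow> w i * b k * divdiff t (\<lambda>m. \<Prod>r<k. t m - t r) 0 i) =
        (case (i, k) of (i, j) \<Rightarrow> if i = j then w i * b j else 0)"
      using divdiff_newton[OF inj, of 0 i k] by simp
  qed simp_all
  moreover have "L l = Q 0"
    by (auto simp: L_def Q_def N_def newton_stage_def)
  moreover have "mat (l + 1) (n + 1) (\<lambda>(i, j). w i * b j * t i ^ j) = Q n"
    unfolding Q_def by (rule cong_mat) (simp_all add: newton_stage_def)
  moreover have "L l = mat_prod (l + 1) (map F (rev [1..<l + 1])) * L 0"
    using F_carrier L_carrier L_step by (rule mat_prod_left_telescope)
  moreover have "Q n = Q 0 * mat_prod (n + 1) (map G [1..<n + 1])"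
    using G_carrier Q_carrier Q_step by (rule mat_prod_right_telescope)
  ultimately have "mat (l + 1) (n + 1) (\<lambda>(i, j). w i * b j * t i ^ j) =
      mat_prod (l + 1) (map F (rev [1..<l + 1])) * D * mat_prod (n + 1) (map G [1..<n + 1])"
    by simp
  moreover have "D \<in> carrier_mat (l + 1) (n + 1)" "diagonal_mat D"
    by (auto simp: D_def diagonal_mat_def)
  moreover have "lower_bidiagonal (F p)" "upper_bidiagonal (G p)" for p
    by (simp_all add: F_def G_def lower_bidiagonal_lower_bidiag upper_bidiagonal_upper_bidiag)
  ultimately show thesis
    using that F_carrier G_carrier by blast
qed

lemma Bernstein_eq_scaled_power:
  assumes "j \<le> n" and "x \<noteq> 1"
  shows "Bernstein n j x = (1 - x) ^ n * real (n choose j) * (x / (1 - x)) ^ j"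
  using assms by (simp add: Bernstein_def power_diff power_divide)

theorem theorem3p2:
  fixes n l :: nat and x :: "nat \<Rightarrow> real"
  assumes "1 \<le> n" and "n \<le> l"
    and "0 < x 1" and "strict_mono_on {1..l + 1} x" and "x (l + 1) < 1"
  shows "\<exists>(F :: nat \<Rightarrow> real mat) (D :: real mat) (G :: nat \<Rightarrow> real mat).
    (\<forall>i\<in>{1..l}. F i \<in> carrier_mat (l + 1) (l + 1) \<and> lower_bidiagonal (F i)) \<and>
    D \<in> carrier_mat (l + 1) (n + 1) \<and> diagonal_mat D \<and>
    (\<forall>j\<in>{1..n}. G j \<in> carrier_mat (n + 1) (n + 1) \<and> upper_bidiagonal (G j)) \<and>
    bernstein_vandermonde l n x =
      mat_prod (l + 1) (map F (rev [1..<l + 1])) * D * mat_prod (n + 1) (map G [1..<n + 1])"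
proof -
  define t where "t i = x (i + 1) / (1 - x (i + 1))" for i
  define w where "w i = (1 - x (i + 1)) ^ n" for i
  have x_lt: "x (i + 1) < 1" if "i \<le> l" for i
  proof -
    have "x (i + 1) \<le> x (l + 1)"
      using strict_mono_on_leD[OF assms(4)] that by simp
    then show ?thesis using assms(5) by simp
  qed
  have inj: "inj_on t {..l}"
  proof (rule inj_onI)
    fix i j assume ij: "i \<in> {..l}" "j \<in> {..l}" and "t i = t j"
    then have "x (i + 1) = x (j + 1)"
      using x_lt[of i] x_lt[of j] by (simp add: t_def field_simps)
    then show "i = j"
      using inj_onD[OF strict_mono_on_imp_inj_on[OF assms(4)], of "i + 1" "j + 1"] ij by simp
  qed
  have w: "w i \<noteq> 0" if "i \<le> l" for i
    using x_lt[OF that] by (simp add: w_def)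
  have b: "real (n choose j) \<noteq> 0" if "j \<le> n" for j
    using that by simp
  have A: "bernstein_vandermonde l n x =
      mat (l + 1) (n + 1) (\<lambda>(i, j). w i * real (n choose j) * t i ^ j)"
    unfolding bernstein_vandermonde_def
  proof (rule cong_mat)
    fix i j assume "i < l + 1" "j < n + 1"
    then show "(case (i, j) of (i, j) \<Rightarrow> Bernstein n j (x (i + 1))) =
        (case (i, j) of (i, j) \<Rightarrow> w i * real (n choose j) * t i ^ j)"
      using Bernstein_eq_scaled_power[of j n "x (i + 1)"] x_lt[of i] by (simp add: w_def t_def)
  qed simp_all
  from inj w b show ?thesis
    unfolding A by (rule scaled_vandermonde_bidiagonal_factorization) blast+
qed

end
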